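(* Let $\mathbb F$ be a finite field with $q$ elements, $A=\mathbb F[t]$, let $\mathfrak p_1,\dots,\mathfrak p_n$ be pairwise distinct places of $A$ and set $d_m:=\deg\mathfrak p_m$ for $m\in\{1,\dots,n\}$. Let $r$ be a positive integer, let $\Omega_r$ be the (finite) set of small Drinfeld models $\phi:A\to A\{\tau\}$ of rank at most $r$ with the uniform distribution, and for a place $\mathfrak p$ let $W_{r,\mathfrak p}:\Omega_r\to\{0,1\}$ be the indicator of whether $\mathfrak p$ is $\phi$-Wieferich in base $1$. If $$r\ge\max(d_1,\dots,d_n)+\log_q\big(2(d_1+\cdots+d_n)\big),$$ then the random variables $W_{r,\mathfrak p_1},\dots,W_{r,\mathfrak p_n}$ are mutually independent.
   Context: $A\{\tau\}$ is the ring of twisted polynomials $\sum c_i\tau^i$ ($c_i\in A$) with $\tau c=c^q\tau$, acting on $A$ by $(\sum c_i\tau^i)(x)=\sum c_ix^{q^i}$. A Drinfeld model of rank $r\ge1$ is an $\mathbb F$-algebra homomorphism $\phi:A\to A\{\tau\}$ with $\phi_t=t+g_1\tau+\cdots+g_r\tau^r$, $g_i\in A$, $g_r\ne0$; it is small if $\deg_tg_i\le q^i$ for all $i$. A place is a monic irreducible polynomial of $A$. For $x\in A$ and an ideal $I$, $\pi_x(\phi;I)=\{a\in A:\phi_a(x)\in I\}$; $\mathfrak p$ is $\phi$-Wieferich in base $x$ if $\pi_x(\phi;\mathfrak p)=\pi_x(\phi;\mathfrak p^2)$.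
   Formalization: The set Ω_r is taken to include also the degenerate homomorphism φ_t = t (all g_i = 0, no positive rank); without it independence fails, e.g. for q = 2, r = 3 and the places t, t+1. *)

theory Defs
  imports
    "HOL-Computational_Algebra.Computational_Algebra"
    "HOL-Probability.Probability"
begin

lemma poly_add_power_card:
  fixes x y :: "'a::finite_field poly"
  shows "(x + y) ^ CARD('a) = x ^ CARD('a) + y ^ CARD('a)"
proof -
  let ?q = "CARD('a)"
  define f :: "'a poly" where "f = (\<Sum>i\<in>{0<..<?q}. monom (of_nat (?q choose i)) i)"
  have q0: "?q > 0" by (simp add: zero_less_card_finite)
  have split: "(\<Sum>i\<le>?q. h i) = h 0 + h ?q + (\<Sum>i\<in>{0<..<?q}. h i)" for h :: "nat \<Rightarrow> 'b::comm_monoid_add"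
  proof -
    have "{..?q} = insert 0 (insert ?q {0<..<?q})" using q0 by auto
    then show ?thesis using q0 by (simp add: add.assoc)
  qed
  have f0: "f = 0"
  proof (rule ccontr)
    assume nz: "f \<noteq> 0"
    have root: "poly f a = 0" for a
    proof -
      have "(a + 1) ^ ?q = (\<Sum>i\<le>?q. of_nat (?q choose i) * a ^ i)"
        by (simp add: binomial_ring)
      also have "\<dots> = 1 + a ^ ?q + poly f a"
        by (subst split) (simp add: f_def poly_sum poly_monom)
      finally show ?thesis
        by (simp add: finite_field_power_card_eq_same)
    qed
    have "card {a. poly f a = 0} \<le> degree f"
      by (rule card_poly_roots_bound) fact
    moreover have "{a. poly f a = 0} = UNIV" using root by auto
    moreover have "degree f < ?q"
    proof -
      have "degree f \<le> ?q - 1" unfolding f_def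
        by (rule degree_sum_le) (auto intro: order.trans[OF degree_monom_le])
      then show ?thesis using q0 by linarith
    qed
    ultimately show False by simp
  qed
  have ch: "of_nat (?q choose i) = (0 :: 'a)" if "i \<in> {0<..<?q}" for i
  proof -
    have "coeff f i = of_nat (?q choose i)"
      unfolding f_def coeff_sum using that by (simp add: if_distrib cong: if_cong)
    then show ?thesis by (simp add: f0)
  qed
  have "(x + y) ^ ?q = (\<Sum>i\<le>?q. of_nat (?q choose i) * x ^ i * y ^ (?q - i))"
    by (simp add: binomial_ring)
  also have "\<dots> = y ^ ?q + x ^ ?q + (\<Sum>i\<in>{0<..<?q}. of_nat (?q choose i) * x ^ i * y ^ (?q - i))"
    by (subst split) simp
  also have "(\<Sum>i\<in>{0<..<?q}. of_nat (?q choose i) * x ^ i * y ^ (?q - i)) = 0"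
    by (rule sum.neutral) (auto simp: ch of_nat_poly)
  finally show ?thesis by (simp add: add.commute)
qed

lemma poly_add_power_card_power:
  fixes x y :: "'a::finite_field poly"
  shows "(x + y) ^ (CARD('a) ^ i) = x ^ (CARD('a) ^ i) + y ^ (CARD('a) ^ i)"
  by (induction i arbitrary: x y) (simp_all add: power_mult poly_add_power_card mult.commute)

lemma zero_power_card_power [simp]: "(0 :: 'b::semiring_1) ^ (CARD('a::finite) ^ i) = 0"
  by (simp add: power_0_left)

lemma poly_sum_power_card_power:
  fixes f :: "'b \<Rightarrow> 'a::finite_field poly"
  shows "(\<Sum>x\<in>S. f x) ^ (CARD('a) ^ i) = (\<Sum>x\<in>S. f x ^ (CARD('a) ^ i))"
  by (induction S rule: infinite_finite_induct) (simp_all add: poly_add_power_card_power)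

text \<open>
  \<open>'a twisted\<close> is the ring \<open>A{\<tau>}\<close> over \<open>A = 'a poly\<close>, where \<open>'a\<close> is a finite field with
  \<open>CARD('a)\<close> elements.  An element \<open>c\<close> stands for the sum of all \<open>tcoeff c i \<cdot> \<tau>^i\<close>.
\<close>

typedef (overloaded) 'a twisted = "{c :: nat \<Rightarrow> 'a::finite_field poly. \<forall>\<^sub>\<infinity> n. c n = 0}"
  morphisms tcoeff Abs_twisted
  by (auto intro!: ALL_MOST)

setup_lifting type_definition_twisted

lemma twisted_eqI: "(\<And>n. tcoeff c n = tcoeff d n) \<Longrightarrow> c = d"
  by (simp add: tcoeff_inject [symmetric] fun_eq_iff)

instantiation twisted :: (finite_field) ring_1
begin

lift_definition zero_twisted :: "'a twisted" is "\<lambda>_. 0" by simp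

lift_definition one_twisted :: "'a twisted" is "\<lambda>n. if n = 0 then 1 else 0"
  by (auto simp: MOST_nat)

lift_definition plus_twisted :: "'a twisted \<Rightarrow> 'a twisted \<Rightarrow> 'a twisted"
  is "\<lambda>c d n. c n + d n"
  by (erule (1) eventually_elim2) simp

lift_definition uminus_twisted :: "'a twisted \<Rightarrow> 'a twisted" is "\<lambda>c n. - c n" by simp

lift_definition minus_twisted :: "'a twisted \<Rightarrow> 'a twisted \<Rightarrow> 'a twisted"
  is "\<lambda>c d n. c n - d n"
  by (erule (1) eventually_elim2) simp

text \<open>The rule \<open>\<tau> c = c^q \<tau>\<close> gives \<open>(c \<tau>^i) (d \<tau>^j) = c d^(q^i) \<tau>^(i+j)\<close>.\<close>

lift_definition times_twisted :: "'a twisted \<Rightarrow> 'a twisted \<Rightarrow> 'a twisted"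
  is "\<lambda>c d n. \<Sum>i\<le>n. c i * d (n - i) ^ (CARD('a) ^ i)"
proof -
  fix c d :: "nat \<Rightarrow> 'a poly"
  assume "\<forall>\<^sub>\<infinity>n. c n = 0" "\<forall>\<^sub>\<infinity>n. d n = 0"
  then obtain k l where k: "\<And>n. n > k \<Longrightarrow> c n = 0" and l: "\<And>n. n > l \<Longrightarrow> d n = 0"
    by (auto simp: MOST_nat)
  have "(\<Sum>i\<le>n. c i * d (n - i) ^ (CARD('a) ^ i)) = 0" if "n > k + l" for n
  proof (rule sum.neutral, intro ballI)
    fix i
    show "c i * d (n - i) ^ (CARD('a) ^ i) = 0"
    proof (cases "i > k")
      case False
      then have "n - i > l" using that by linarith
      then show ?thesis by (simp add: l)
    qed (simp add: k)
  qed
  then show "\<forall>\<^sub>\<infinity>n. (\<Sum>i\<le>n. c i * d (n - i) ^ (CARD('a) ^ i)) = 0"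
    by (auto simp: MOST_nat)
qed

instance
proof
  fix a b c :: "'a twisted"
  show "a + b + c = a + (b + c)" "a + b = b + a" "0 + a = a" "- a + a = 0" "a - b = a + - b"
    by (transfer; simp add: fun_eq_iff algebra_simps)+
  show "(0 :: 'a twisted) \<noteq> 1"
    by transfer (auto simp: fun_eq_iff)
  show "1 * a = a"
    by transfer (auto simp: fun_eq_iff if_distrib[of "\<lambda>x. x * _"] cong: if_cong)
  show "a * 1 = a"
  proof (transfer, rule ext)
    fix a :: "nat \<Rightarrow> 'a poly" and n
    have "(\<Sum>i\<le>n. a i * (if n - i = 0 then 1 else 0) ^ (CARD('a) ^ i))
        = (\<Sum>i\<le>n. if i = n then a i else 0)"
      by (rule sum.cong) auto
    then show "(\<Sum>i\<le>n. a i * (if n - i = 0 then 1 else 0) ^ (CARD('a) ^ i)) = a n"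
      by simp
  qed
  show "(a + b) * c = a * c + b * c"
    by transfer (simp add: fun_eq_iff algebra_simps sum.distrib)
  show "a * (b + c) = a * b + a * c"
    by transfer (simp add: fun_eq_iff poly_add_power_card_power algebra_simps sum.distrib)
  show "a * b * c = a * (b * c)"
  proof (transfer, rule ext)
    fix a b c :: "nat \<Rightarrow> 'a poly" and n
    define f where "f i j l = a i * b j ^ (CARD('a) ^ i) * c l ^ (CARD('a) ^ (i + j))" for i j l
    have "(\<Sum>i\<le>n. (\<Sum>j\<le>i. a j * b (i - j) ^ (CARD('a) ^ j)) * c (n - i) ^ (CARD('a) ^ i))
        = (\<Sum>i=0..n. \<Sum>j=0..i. f j (i - j) (n - i))"
      by (simp add: f_def sum_distrib_right atMost_atLeast0)
    also have "\<dots> = (\<Sum>j=0..n. \<Sum>i=0..n - j. f j i (n - j - i))"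
      by (rule fps_mult_assoc_lemma)
    also have "\<dots> = (\<Sum>i\<le>n. a i * (\<Sum>j\<le>n - i. b j * c (n - i - j) ^ (CARD('a) ^ j)) ^ (CARD('a) ^ i))"
      by (simp add: f_def poly_sum_power_card_power sum_distrib_left power_mult_distrib
          atMost_atLeast0 power_add mult.assoc mult.commute flip: power_mult)
    finally show "(\<Sum>i\<le>n. (\<Sum>j\<le>i. a j * b (i - j) ^ (CARD('a) ^ j)) * c (n - i) ^ (CARD('a) ^ i))
        = (\<Sum>i\<le>n. a i * (\<Sum>j\<le>n - i. b j * c (n - i - j) ^ (CARD('a) ^ j)) ^ (CARD('a) ^ i))" .
  qed
qed

end

definition tconst :: "'a::finite_field poly \<Rightarrow> 'a twisted"
  where "tconst a = Abs_twisted (\<lambda>n. if n = 0 then a else 0)"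

lemma tcoeff_tconst [simp]: "tcoeff (tconst a) n = (if n = 0 then a else 0)"
proof -
  have "\<forall>\<^sub>\<infinity>n. (if n = 0 then a else 0) = 0"
    by (auto simp: MOST_nat)
  then show ?thesis by (simp add: tconst_def Abs_twisted_inverse)
qed

definition tau :: "'a::finite_field twisted"
  where "tau = Abs_twisted (\<lambda>n. if n = 1 then 1 else 0)"

lemma tcoeff_tau [simp]: "tcoeff (tau :: 'a::finite_field twisted) n = (if n = 1 then 1 else 0)"
proof -
  have "\<forall>\<^sub>\<infinity>n. (if n = 1 then 1 else 0 :: 'a poly) = 0"
    by (auto simp: MOST_nat intro!: exI[of _ 1])
  then show ?thesis by (simp add: tau_def Abs_twisted_inverse)
qed

lemma tau_tconst: "tau * tconst c = tconst (c ^ CARD('a)) * tau"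
  for c :: "'a::finite_field poly"
proof (rule twisted_eqI)
  fix n
  have "tcoeff (tau * tconst c) n
      = (\<Sum>i\<le>n. if i = 1 then (if n = 1 then c ^ CARD('a) else 0) else 0)"
    unfolding times_twisted.rep_eq by (rule sum.cong) auto
  moreover have "tcoeff (tconst (c ^ CARD('a)) * tau) n
      = (\<Sum>i\<le>n. if i = 0 then (if n = 1 then c ^ CARD('a) else 0) else 0)"
    unfolding times_twisted.rep_eq by (rule sum.cong) auto
  ultimately show "tcoeff (tau * tconst c) n = tcoeff (tconst (c ^ CARD('a)) * tau) n"
    by auto
qed

definition tact :: "'a::finite_field twisted \<Rightarrow> 'a poly \<Rightarrow> 'a poly"
  where "tact c x = (\<Sum>i | tcoeff c i \<noteq> 0. tcoeff c i * x ^ (CARD('a) ^ i))"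

definition drinfeld_model :: "nat \<Rightarrow> ('a::finite_field poly \<Rightarrow> 'a twisted) \<Rightarrow> bool"
  where "drinfeld_model r \<phi> \<longleftrightarrow>
    r \<ge> 1 \<and>
    (\<forall>a b. \<phi> (a + b) = \<phi> a + \<phi> b) \<and>
    (\<forall>a b. \<phi> (a * b) = \<phi> a * \<phi> b) \<and>
    (\<forall>c. \<phi> [:c:] = tconst [:c:]) \<and>
    tcoeff (\<phi> [:0, 1:]) 0 = [:0, 1:] \<and>
    tcoeff (\<phi> [:0, 1:]) r \<noteq> 0 \<and>
    (\<forall>i>r. tcoeff (\<phi> [:0, 1:]) i = 0)"

definition small_model :: "('a::finite_field poly \<Rightarrow> 'a twisted) \<Rightarrow> bool"
  where "small_model \<phi> \<longleftrightarrow> (\<forall>i\<ge>1. degree (tcoeff (\<phi> [:0, 1:]) i) \<le> CARD('a) ^ i)"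

text \<open>
  \<open>tconst\<close> itself is the homomorphism with \<open>\<phi>_t = t\<close>, that is, the case in which all \<open>g_i\<close>
  vanish.  It has no positive rank, but it is counted here as a (degenerate) model of rank at
  most \<open>r\<close>, so that \<open>small_models r\<close> corresponds to all tuples \<open>(g_1, \<dots>, g_r)\<close> with
  \<open>deg g_i \<le> q^i\<close>.  Without this one point the uniform distribution is not the product
  distribution on the coefficients, and exact independence fails: for \<open>q = 2\<close>, \<open>r = 3\<close> and the
  places \<open>t\<close>, \<open>t + 1\<close> there are \<open>N = 2^17\<close> tuples, the two Wieferich events (base 1) contain
  \<open>N/2\<close> of them each and their intersection \<open>N/4\<close>, and \<open>tconst\<close> lies in neither event.
\<close>

definition small_models :: "nat \<Rightarrow> ('a::finite_field poly \<Rightarrow> 'a twisted) set"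
  where "small_models r = insert tconst {\<phi>. small_model \<phi> \<and> (\<exists>s\<le>r. drinfeld_model s \<phi>)}"

definition place :: "'a::finite_field poly \<Rightarrow> bool"
  where "place p \<longleftrightarrow> irreducible p \<and> lead_coeff p = 1"

definition principal_ideal :: "'a::comm_ring_1 \<Rightarrow> 'a set"
  where "principal_ideal p = {p * b | b. True}"

definition pi_ideal ::
    "'a::finite_field poly \<Rightarrow> ('a poly \<Rightarrow> 'a twisted) \<Rightarrow> 'a poly set \<Rightarrow> 'a poly set"
  where "pi_ideal x \<phi> I = {a. tact (\<phi> a) x \<in> I}"

definition wieferich ::
    "('a::finite_field poly \<Rightarrow> 'a twisted) \<Rightarrow> 'a poly \<Rightarrow> 'a poly \<Rightarrow> bool"
  where "wieferich \<phi> x p \<longleftrightarrow>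
    pi_ideal x \<phi> (principal_ideal p) = pi_ideal x \<phi> (principal_ideal (p ^ 2))"

definition wieferich_var :: "'a::finite_field poly \<Rightarrow> ('a poly \<Rightarrow> 'a twisted) \<Rightarrow> nat"
  where "wieferich_var p \<phi> = of_bool (wieferich \<phi> 1 p)"

end

theory Submission
  imports Defs
begin

text \<open>
  Write \<open>\<phi>\<^sub>t = t + c\<close>, so that \<open>\<phi>\<close> ranges over the models with \<open>c\<close> in the finite group \<open>V\<close> of twisted
  polynomials \<open>g\<^sub>1 \<tau> + \<dots> + g\<^sub>r \<tau>\<^sup>r\<close> with \<open>deg g\<^sub>i \<le> q^i\<close>.  Whether \<open>p\<close> is Wieferich depends only on the
  class of \<open>c\<close> modulo the subgroup \<open>K\<^sub>p\<close> of those twisted polynomials that map \<open>A\<close> into \<open>(p\<^sup>2)\<close>.  Hence it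
  suffices that \<open>V\<close> maps onto the product of the quotients \<open>V / (V \<inter> K\<^sub>p)\<close>: functions of the different
  components are then independent.  For surjectivity, \<open>x^(q^(i+d)) \<equiv> x^(q^i)\<close> modulo \<open>p\<^sup>2\<close> for \<open>i \<ge> 1\<close> and
  \<open>d = deg p\<close>, so every class is represented by coefficients in the positions \<open>r - d + 1, \<dots>, r\<close> alone.
  There the degree bound \<open>q^i\<close> is at least the degree of the product of all \<open>p\<^sup>2\<close>, so the Chinese
  remainder theorem prescribes the coefficients modulo all \<open>p\<^sup>2\<close> at once.
\<close>

subsection \<open>Independence of invariant functions on a finite group\<close>

definition add_subgroup :: "'g::ab_group_add set \<Rightarrow> bool"
  where "add_subgroup S \<longleftrightarrow> 0 \<in> S \<and> (\<forall>a\<in>S. \<forall>b\<in>S. a - b \<in> S)"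

lemma add_subgroup_0: "add_subgroup S \<Longrightarrow> 0 \<in> S"
  by (simp add: add_subgroup_def)

lemma add_subgroup_diff: "add_subgroup S \<Longrightarrow> a \<in> S \<Longrightarrow> b \<in> S \<Longrightarrow> a - b \<in> S"
  by (simp add: add_subgroup_def)

lemma add_subgroup_uminus: "add_subgroup S \<Longrightarrow> a \<in> S \<Longrightarrow> - a \<in> S"
  using add_subgroup_diff[of S 0 a] by (simp add: add_subgroup_0)

lemma add_subgroup_add: "add_subgroup S \<Longrightarrow> a \<in> S \<Longrightarrow> b \<in> S \<Longrightarrow> a + b \<in> S"
  using add_subgroup_diff[of S a "- b"] by (simp add: add_subgroup_uminus)

text \<open>Double counting of the pairs (v, k) with v in G, k in \<open>K\<close> and v - k in
  \<open>E\<close>: all fibres over v have the same size, because modulo \<open>H\<close> the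
  element v may be replaced by its component in \<open>K\<close>. Comparing G = \<open>V\<close>
  with G = \<open>F\<close> gives the product formula.\<close>

lemma card_Int_invariant:
  fixes V :: "'g::ab_group_add set"
  assumes V: "finite V" "add_subgroup V"
    and H: "add_subgroup H" and K: "add_subgroup K" "K \<subseteq> V"
    and decomp: "\<And>v. v \<in> V \<Longrightarrow> \<exists>a\<in>H \<inter> V. \<exists>b\<in>K. v = a + b"
    and E: "E \<subseteq> V" "\<And>v w. v \<in> E \<Longrightarrow> w \<in> V \<Longrightarrow> w - v \<in> H \<Longrightarrow> w \<in> E"
    and F: "F \<subseteq> V" "\<And>v w. v \<in> F \<Longrightarrow> w \<in> V \<Longrightarrow> w - v \<in> K \<Longrightarrow> w \<in> F"
  shows "card (E \<inter> F) * card V = card E * card F"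
proof -
  have finK: "finite K" using V(1) K(2) by (rule rev_finite_subset)
  have fibre: "card {k \<in> K. v - k \<in> E} = card (K \<inter> E)" if v: "v \<in> V" for v
  proof -
    obtain a b where ab: "a \<in> H" "a \<in> V" "b \<in> K" "v = a + b" using decomp[OF v] by blast
    have "v - k \<in> E \<longleftrightarrow> b - k \<in> E" if k: "k \<in> K" for k
    proof -
      have "v - k \<in> V" "b - k \<in> V"
        using add_subgroup_diff[OF V(2)] v k ab K(2) by auto
      moreover have "(v - k) - (b - k) \<in> H" "(b - k) - (v - k) \<in> H"
        using add_subgroup_uminus[OF H] ab by auto
      ultimately show ?thesis using E(2) by blast
    qed
    then have "{k \<in> K. v - k \<in> E} = {k \<in> K. b - k \<in> E}" by blast
    also have "card \<dots> = card (K \<inter> E)"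
      by (rule bij_betw_same_card[of "\<lambda>k. b - k"], rule bij_betwI[where g = "\<lambda>k. b - k"])
        (use ab add_subgroup_diff[OF K(1)] in auto)
    finally show ?thesis .
  qed
  have count: "card G * card (K \<inter> E) = card (E \<inter> G) * card K"
    if G: "G \<subseteq> V" "\<And>v w. v \<in> G \<Longrightarrow> w \<in> V \<Longrightarrow> w - v \<in> K \<Longrightarrow> w \<in> G" for G
  proof -
    have finG: "finite G" using V(1) G(1) by (rule rev_finite_subset)
    have "card G * card (K \<inter> E) = (\<Sum>v\<in>G. card {k \<in> K. v - k \<in> E})"
      using G(1) by (simp add: fibre subset_iff)
    also have "\<dots> = card (SIGMA v:G. {k \<in> K. v - k \<in> E})"
      using finG finK by (simp add: card_SigmaI)
    \<comment> \<open>The shear (v, k) -> (v - k, k); stability of G under \<open>K\<close> keeps it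
      and its inverse inside G.\<close>
    also have "\<dots> = card ((E \<inter> G) \<times> K)"
    proof (rule bij_betw_same_card[of "\<lambda>(v, k). (v - k, k)"],
        rule bij_betwI[where g = "\<lambda>(v, k). (v + k, k)"])
      show "(\<lambda>(v, k). (v - k, k)) \<in> (SIGMA v:G. {k \<in> K. v - k \<in> E}) \<rightarrow> (E \<inter> G) \<times> K"
      proof clarsimp
        fix v k assume vk: "v \<in> G" "k \<in> K" "v - k \<in> E"
        have "v - k \<in> V" using vk(3) E(1) by blast
        moreover have "(v - k) - v \<in> K" using add_subgroup_uminus[OF K(1) vk(2)] by simp
        ultimately show "v - k \<in> G" by (rule G(2)[OF vk(1)])
      qed
      show "(\<lambda>(v, k). (v + k, k)) \<in> (E \<inter> G) \<times> K \<rightarrow> (SIGMA v:G. {k \<in> K. v - k \<in> E})"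
      proof clarsimp
        fix v k assume vk: "v \<in> E" "v \<in> G" "k \<in> K"
        have "v \<in> V" "k \<in> V" using vk E(1) K(2) by auto
        then have "v + k \<in> V" by (rule add_subgroup_add[OF V(2)])
        moreover have "(v + k) - v \<in> K" using vk by simp
        ultimately show "v + k \<in> G" by (rule G(2)[OF vk(2)])
      qed
    qed auto
    finally show ?thesis by (simp add: card_cartesian_product)
  qed
  have count_V: "card V * card (K \<inter> E) = card E * card K"
    using count[of V] E(1) by (simp add: Int_absorb2)
  have count_F: "card F * card (K \<inter> E) = card (E \<inter> F) * card K"
    using F by (rule count)
  \<comment> \<open>\<open>card (K \<inter> E)\<close> may be zero, so it is traded between the two
    counts; only the positive \<open>card K\<close> is cancelled.\<close>
  have "card (E \<inter> F) * card V * card K = (card F * card (K \<inter> E)) * card V"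
    unfolding count_F by (simp only: mult_ac)
  also have "\<dots> = card F * (card V * card (K \<inter> E))"
    by (simp only: mult_ac)
  also have "\<dots> = card E * card F * card K"
    unfolding count_V by (simp only: mult_ac)
  finally have "card (E \<inter> F) * card V * card K = card E * card F * card K" .
  moreover have "card K > 0"
    using finK add_subgroup_0[OF K(1)] by (auto simp: card_gt_0_iff)
  ultimately show ?thesis by simp
qed

text \<open>Induction on \<open>J\<close>: \<open>E i\<close> is stable under \<open>K i\<close>,
  the intersection of the other events under the intersection of their subgroups, and by
  \<open>split\<close> every element of \<open>V\<close> is a sum from these two subgroups.\<close>

lemma card_INT_invariant:
  fixes V :: "'g::ab_group_add set"
  assumes V: "finite V" "add_subgroup V"
    and K: "\<And>i. i \<in> I \<Longrightarrow> add_subgroup (K i)"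
    and split: "\<And>i v. i \<in> I \<Longrightarrow> v \<in> V \<Longrightarrow> \<exists>w\<in>V. w - v \<in> K i \<and> (\<forall>j\<in>I - {i}. w \<in> K j)"
    and E: "\<And>i. i \<in> I \<Longrightarrow> E i \<subseteq> V"
      "\<And>i v w. i \<in> I \<Longrightarrow> v \<in> E i \<Longrightarrow> w \<in> V \<Longrightarrow> w - v \<in> K i \<Longrightarrow> w \<in> E i"
    and J: "finite J" "J \<subseteq> I"
  shows "card {v\<in>V. \<forall>j\<in>J. v \<in> E j} / card V = (\<Prod>j\<in>J. card (E j) / card V)"
  using J
proof (induction J rule: finite_induct)
  case empty
  have "card V \<noteq> 0" using V add_subgroup_0 by auto
  then show ?case by simp
next
  case (insert i J)
  define F where "F = {v\<in>V. \<forall>j\<in>J. v \<in> E j}"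
  define L where "L = {w\<in>V. \<forall>j\<in>J. w \<in> K j}"
  from insert have i: "i \<in> I" "i \<notin> J" "J \<subseteq> I" by auto
  have L: "add_subgroup L"
    unfolding L_def add_subgroup_def using V(2) K i(3)
    by (auto simp: subset_iff add_subgroup_0 add_subgroup_diff)
  have "card (E i \<inter> F) * card V = card (E i) * card F"
  proof (rule card_Int_invariant[OF V K[OF i(1)] L])
    show "L \<subseteq> V" by (auto simp: L_def)
    show "\<exists>a\<in>K i \<inter> V. \<exists>b\<in>L. v = a + b" if v: "v \<in> V" for v
    proof -
      obtain w where w: "w \<in> V" "w - v \<in> K i" "\<forall>j\<in>I - {i}. w \<in> K j"
        using split[OF i(1) v] by blast
      have "w \<in> L" using w i by (auto simp: L_def)
      moreover have "v - w \<in> K i" using add_subgroup_uminus[OF K[OF i(1)] w(2)] by simp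
      moreover have "v - w \<in> V" using V(2) v w(1) by (rule add_subgroup_diff)
      ultimately show ?thesis
        by (intro bexI[of _ "v - w"] bexI[of _ w]) auto
    qed
    show "F \<subseteq> V" by (auto simp: F_def)
    show "w \<in> F" if "v \<in> F" "w \<in> V" "w - v \<in> L" for v w
      using that E(2) i(3) by (auto simp: F_def L_def subset_iff)
  qed (use E i in auto)
  moreover have "{v\<in>V. \<forall>j\<in>insert i J. v \<in> E j} = E i \<inter> F"
    using E(1)[OF i(1)] by (auto simp: F_def)
  moreover have "card V \<noteq> 0" using V add_subgroup_0 by auto
  ultimately have "card {v\<in>V. \<forall>j\<in>insert i J. v \<in> E j} / card V = card (E i) / card V * (card F / card V)"
    by (simp add: field_simps flip: of_nat_mult)
  then show ?case using insert i by (simp add: F_def)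
qed

text \<open>The injection \<open>h\<close> turns the uniform measure on its image into counting in
  \<open>V\<close>, and an event about \<open>X j\<close> into a subset of \<open>V\<close> stable
  under \<open>K j\<close>; independence becomes the product formula for cardinalities.\<close>

lemma indep_vars_uniform_count_measure_image:
  fixes V :: "'g::ab_group_add set"
  assumes V: "finite V" "add_subgroup V" and inj: "inj_on h V"
    and K: "\<And>i. i \<in> I \<Longrightarrow> add_subgroup (K i)"
    and split: "\<And>i v. i \<in> I \<Longrightarrow> v \<in> V \<Longrightarrow> \<exists>w\<in>V. w - v \<in> K i \<and> (\<forall>j\<in>I - {i}. w \<in> K j)"
    and X: "\<And>i v. i \<in> I \<Longrightarrow> v \<in> V \<Longrightarrow> X i (h v) \<in> N"
      "\<And>i v w. i \<in> I \<Longrightarrow> v \<in> V \<Longrightarrow> w \<in> V \<Longrightarrow> w - v \<in> K i \<Longrightarrow> X i (h w) = X i (h v)"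
  shows "prob_space.indep_vars (uniform_count_measure (h ` V)) (\<lambda>_. count_space N) X I"
proof -
  let ?M = "uniform_count_measure (h ` V)"
  have fin: "finite (h ` V)" "h ` V \<noteq> {}" using V add_subgroup_0 by auto
  interpret prob_space ?M by (rule prob_space_uniform_count_measure[OF fin])
  have sp: "space ?M = h ` V" by (simp add: space_uniform_count_measure)
  have st: "sets ?M = Pow (h ` V)" by (simp add: sets_uniform_count_measure)
  have pr: "prob S = card {v\<in>V. h v \<in> S} / card V" if "S \<subseteq> h ` V" for S
  proof -
    have "S = h ` {v\<in>V. h v \<in> S}" using that by auto
    then have "card S = card {v\<in>V. h v \<in> S}"
      using inj by (metis (no_types, lifting) card_image inj_on_subset mem_Collect_eq subsetI)
    then show ?thesis
      using that fin inj by (simp add: measure_uniform_count_measure card_image)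
  qed
  show ?thesis
    unfolding indep_vars_def2
  proof (intro conjI ballI indep_setsI)
    fix i assume "i \<in> I"
    then show "X i \<in> measurable ?M (count_space N)"
      using X(1) by (auto simp: measurable_def sp st)
  next
    fix i assume "i \<in> I"
    show "{X i -` A \<inter> space ?M |A. A \<in> sets (count_space N)} \<subseteq> events"
      by (auto simp: sp st)
  next
    fix A J
    assume J: "J \<noteq> {}" "J \<subseteq> I" "finite J"
      and "\<forall>j\<in>J. A j \<in> {X j -` B \<inter> space ?M |B. B \<in> sets (count_space N)}"
    then obtain B where B: "\<And>j. j \<in> J \<Longrightarrow> A j = X j -` B j \<inter> h ` V"
      unfolding sp by (auto simp: Bex_def) metis
    define E where "E j = {v\<in>V. X j (h v) \<in> B j}" for j
    have "card {v\<in>V. \<forall>j\<in>J. v \<in> E j} / card V = (\<Prod>j\<in>J. card (E j) / card V)"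
    proof (rule card_INT_invariant[where I = I and K = K, OF V K split])
      show "w \<in> E i" if "i \<in> I" "v \<in> E i" "w \<in> V" "w - v \<in> K i" for i v w
        using X(2)[of i v w] that by (simp add: E_def)
    qed (use J in \<open>auto simp: E_def\<close>)
    moreover have "prob (A j) = card (E j) / card V" if "j \<in> J" for j
      using that by (subst pr) (auto simp: B E_def intro!: arg_cong[where f = card])
    moreover have "prob (\<Inter>j\<in>J. A j) = card {v\<in>V. \<forall>j\<in>J. v \<in> E j} / card V"
      using J(1) by (subst pr) (auto simp: B E_def intro!: arg_cong[where f = card])
    ultimately show "prob (\<Inter>j\<in>J. A j) = (\<Prod>j\<in>J. prob (A j))" by simp
  qed
qed

subsection \<open>Frobenius powers modulo squares of places\<close>

lemma card_finite_field_ge_2: "CARD('a::finite_field) \<ge> 2"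
proof -
  have "card {0, 1 :: 'a} \<le> CARD('a)" by (rule card_mono) auto
  then show ?thesis by simp
qed

lemma poly_diff_power_card_power:
  fixes x y :: "'a::finite_field poly"
  shows "(x - y) ^ (CARD('a) ^ i) = x ^ (CARD('a) ^ i) - y ^ (CARD('a) ^ i)"
  using poly_add_power_card_power[of "x - y" y i] by simp

text \<open>Frobenius additivity turns the difference into (x - y)^(q^i), which contains p at least
  q^i \<ge> 2 times since i \<ge> 1.\<close>

lemma dvd_power_card_power_diff:
  fixes x y :: "'a::finite_field poly"
  assumes "p dvd x - y" "i \<ge> 1"
  shows "p ^ 2 dvd x ^ (CARD('a) ^ i) - y ^ (CARD('a) ^ i)"
proof -
  have "CARD('a) ^ 1 \<le> CARD('a) ^ i"
    using assms(2) card_finite_field_ge_2[where 'a = 'a] by (intro power_increasing) auto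
  then have "p ^ 2 dvd p ^ (CARD('a) ^ i)"
    using card_finite_field_ge_2[where 'a = 'a] by (intro le_imp_power_dvd) auto
  also have "p ^ (CARD('a) ^ i) dvd (x - y) ^ (CARD('a) ^ i)"
    using assms(1) by (rule dvd_power_same)
  finally show ?thesis by (simp add: poly_diff_power_card_power)
qed

section \<open>Counting residues and Fermat's little theorem for places\<close>

lemma coeffs_bounded_Suc:
  "{f :: 'a::zero poly. \<forall>i\<ge>Suc d. coeff f i = 0} =
    (\<lambda>(a, f). pCons a f) ` (UNIV \<times> {f. \<forall>i\<ge>d. coeff f i = 0})"
proof (intro equalityI subsetI)
  fix f :: "'a poly" assume f: "f \<in> {f. \<forall>i\<ge>Suc d. coeff f i = 0}"
  obtain a g where fg: "f = pCons a g" by (cases f)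
  have "coeff g i = 0" if "i \<ge> d" for i using f that fg by (auto dest!: spec[of _ "Suc i"])
  then show "f \<in> (\<lambda>(a, f). pCons a f) ` (UNIV \<times> {f. \<forall>i\<ge>d. coeff f i = 0})"
    using fg by auto
qed (auto simp: coeff_pCons split: nat.split)

text \<open>Unlike \<open>degree f < d\<close>, the vanishing of coefficients also describes the
  case d = 0, where only 0 remains.\<close>

lemma finite_card_coeffs_bounded:
  "finite {f :: 'a::{finite,zero} poly. \<forall>i\<ge>d. coeff f i = 0} \<and>
   card {f :: 'a poly. \<forall>i\<ge>d. coeff f i = 0} = CARD('a) ^ d"
proof (induction d)
  case 0
  have "{f :: 'a poly. \<forall>i\<ge>0. coeff f i = 0} = {0}" by (auto simp: poly_eq_iff)
  then show ?case by simp
next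
  case (Suc d)
  have "inj_on (\<lambda>(a, f :: 'a poly). pCons a f) S" for S by (auto simp: inj_on_def)
  then show ?case unfolding coeffs_bounded_Suc
    using Suc by (simp add: card_image card_cartesian_product)
qed

lemma finite_degree_le: "finite {f :: 'a::{finite,zero} poly. degree f \<le> d}"
  by (rule finite_subset[OF _ conjunct1[OF finite_card_coeffs_bounded[of "Suc d"]]])
    (auto intro: coeff_eq_0)

lemma degree_place_pos: "place p \<Longrightarrow> degree p > 0"
  for p :: "'a::finite_field poly"
  unfolding place_def by (metis gr0I irreducible_def is_unit_iff_degree)

lemma prime_elem_dvd_prodD:
  assumes "prime_elem p" "finite S" "p dvd prod f S"
  shows "\<exists>s\<in>S. p dvd f s"
  using assms(2,3)
proof (induction S rule: finite_induct)
  case empty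
  then show ?case using prime_elem_not_unit[OF assms(1)] by simp
next
  case (insert s S)
  then have "p dvd f s \<or> p dvd prod f S"
    using prime_elem_dvd_multD[OF assms(1)] by simp
  then show ?case using insert.IH by auto
qed

text \<open>As in Fermat's theorem, multiplication by \<open>x\<close> permutes the q^d - 1 nonzero
  residues modulo \<open>p\<close>; their product, prime to \<open>p\<close>, is compared before and
  after and cancelled.\<close>

lemma place_fermat_power:
  fixes p x :: "'a::finite_field poly"
  assumes p: "place p" and x: "\<not> p dvd x"
  shows "p dvd x ^ (CARD('a) ^ degree p - 1) - 1"
proof -
  define d where "d = degree p"
  define R where "R = {f :: 'a poly. \<forall>i\<ge>d. coeff f i = 0}"
  have prime: "prime_elem p"
    using p by (simp add: place_def field_poly_irreducible_imp_prime)
  have d: "d > 0" using degree_place_pos[OF p] by (simp add: d_def)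
  have R: "f \<in> R \<longleftrightarrow> degree f < d" for f
    unfolding R_def using d by (auto intro: coeff_eq_0) (metis leading_coeff_0_iff not_less degree_0)
  have fin: "finite (R - {0})" and card: "card (R - {0}) = CARD('a) ^ d - 1"
    using finite_card_coeffs_bounded[where 'a = 'a, of d] by (auto simp: R_def)
  have nd: "\<not> p dvd f" if "f \<in> R - {0}" for f
    using that R[of f] dvd_imp_degree_le[of p f] by (auto simp: d_def)
  have mod_R: "f mod p \<in> R - {0}" if "\<not> p dvd f" for f
  proof -
    have "f mod p \<noteq> 0" "p \<noteq> 0" using that p by (auto simp: mod_eq_0_iff_dvd place_def)
    then show ?thesis using degree_mod_less'[of p f] by (simp add: R d_def)
  qed
  have inj: "inj_on (\<lambda>f. (x * f) mod p) (R - {0})"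
  proof (rule inj_onI)
    fix f g assume fg: "f \<in> R - {0}" "g \<in> R - {0}" "(x * f) mod p = (x * g) mod p"
    have "p dvd x * f - x * g" using fg(3) by (simp only: mod_eq_dvd_iff)
    then have "p dvd x * (f - g)" by (simp add: right_diff_distrib)
    then have dvd: "p dvd f - g" using prime x by (simp add: prime_elem_dvd_mult_iff)
    have "degree (f - g) < degree p"
      using fg(1,2) R[of f] R[of g] degree_diff_le_max[of f g] by (simp add: d_def max_def split: if_splits)
    then show "f = g"
      using dvd dvd_imp_degree_le[of p "f - g"] by fastforce
  qed
  have "(\<lambda>f. (x * f) mod p) ` (R - {0}) = R - {0}"
  proof (rule endo_inj_surj[OF fin _ inj], rule image_subsetI)
    fix f assume "f \<in> R - {0}"
    then have "\<not> p dvd x * f"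
      using nd[of f] x prime_elem_dvd_multD[OF prime, of x f] by blast
    then show "(x * f) mod p \<in> R - {0}" by (rule mod_R)
  qed
  then have "(\<Prod>f\<in>R - {0}. f) = (\<Prod>f\<in>R - {0}. (x * f) mod p)"
    using prod.reindex[OF inj, of "\<lambda>f. f"] by simp
  then have "(\<Prod>f\<in>R - {0}. f) mod p = (\<Prod>f\<in>R - {0}. x * f) mod p"
    by (simp add: mod_prod_eq)
  also have "(\<Prod>f\<in>R - {0}. x * f) = x ^ (CARD('a) ^ d - 1) * (\<Prod>f\<in>R - {0}. f)"
    by (simp only: prod.distrib prod_constant card)
  finally have "p dvd (x ^ (CARD('a) ^ d - 1) - 1) * (\<Prod>f\<in>R - {0}. f)"
    by (metis mod_eq_dvd_iff mult_1 left_diff_distrib)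
  moreover have "\<not> p dvd (\<Prod>f\<in>R - {0}. f)"
    using prime_elem_dvd_prodD[OF prime fin, of "\<lambda>f. f"] nd by auto
  ultimately show ?thesis using prime by (simp add: prime_elem_dvd_mult_iff d_def)
qed

lemma place_fermat:
  fixes p x :: "'a::finite_field poly"
  assumes p: "place p"
  shows "p dvd x ^ (CARD('a) ^ degree p) - x"
proof (cases "p dvd x")
  case True
  then show ?thesis
    by (intro dvd_diff dvd_trans[OF True dvd_power]) (simp_all add: zero_less_card_finite)
next
  case False
  have "x ^ (CARD('a) ^ degree p) - x = x * (x ^ (CARD('a) ^ degree p - 1) - 1)"
    by (simp add: right_diff_distrib flip: power_Suc)
  then show ?thesis using place_fermat_power[OF p False] by simp
qed

text \<open>Fermat's congruence x^(q^d) \<equiv> x modulo \<open>p\<close>, raised to the power q^j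
  with j \<ge> 1, holds modulo p^2. This shifts j by one period d; \<open>k\<close> such shifts are
  chained.\<close>

lemma place_power_card_shift:
  fixes p x :: "'a::finite_field poly"
  assumes p: "place p" and i: "i \<ge> 1"
  shows "p ^ 2 dvd x ^ (CARD('a) ^ (i + k * degree p)) - x ^ (CARD('a) ^ i)"
proof (induction k)
  case (Suc k)
  let ?j = "i + k * degree p"
  have "p ^ 2 dvd (x ^ (CARD('a) ^ degree p)) ^ (CARD('a) ^ ?j) - x ^ (CARD('a) ^ ?j)"
    using i by (intro dvd_power_card_power_diff place_fermat[OF p]) auto
  then have "p ^ 2 dvd x ^ (CARD('a) ^ (i + Suc k * degree p)) - x ^ (CARD('a) ^ ?j)"
    by (simp add: power_add algebra_simps flip: power_mult)
  from dvd_add[OF this Suc] show ?case by simp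
qed simp

section \<open>Idempotents separating the squares of distinct places\<close>

lemma place_dvd_place: "place p \<Longrightarrow> place p' \<Longrightarrow> p dvd p' \<Longrightarrow> p = p'"
  for p p' :: "'a::finite_field poly"
proof -
  assume p: "place p" "place p'" and "p dvd p'"
  then obtain c where c: "p' = p * c" by (elim dvdE)
  have "\<not> is_unit p" using p(1) by (auto simp: place_def dest: irreducible_not_unit)
  then have "is_unit c" using c p(2) by (auto simp: place_def dest: irreducibleD)
  moreover have "lead_coeff c = 1"
    using p c lead_coeff_mult[of p c] by (simp add: place_def)
  moreover obtain k where "c = [:k:]" using \<open>is_unit c\<close> unfolding is_unit_poly_iff by blast
  ultimately have "c = 1" by (simp add: one_pCons)
  then show "p = p'" by (simp add: c)
qed

text \<open>By Fermat, \<open>N ^ (q ^ d - 1) \<equiv> 1\<close> modulo \<open>p\<close>, and one more Frobenius lifts this to \<open>p ^ 2\<close>;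
  no Bezout identity is needed.\<close>

lemma place_idempotent:
  fixes p :: "nat \<Rightarrow> 'a::finite_field poly"
  assumes "finite I" and pl: "\<And>m. m \<in> I \<Longrightarrow> place (p m)" and inj: "inj_on p I" and m: "m \<in> I"
  obtains e where "p m ^ 2 dvd e - 1" "\<And>j. j \<in> I \<Longrightarrow> j \<noteq> m \<Longrightarrow> p j ^ 2 dvd e"
proof -
  define N where "N = (\<Prod>j\<in>I - {m}. p j)"
  define e where "e = (N ^ (CARD('a) ^ degree (p m) - 1)) ^ CARD('a)"
  have prime: "prime_elem (p m)"
    using pl[OF m] by (simp add: place_def field_poly_irreducible_imp_prime)
  have "\<not> p m dvd p j" if "j \<in> I - {m}" for j
    using place_dvd_place[of "p m" "p j"] pl m that inj by (auto simp: inj_on_def)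
  then have "\<not> p m dvd N"
    using prime_elem_dvd_prodD[OF prime finite_Diff[OF assms(1)], of p "{m}"] by (auto simp: N_def)
  then have "p m ^ 2 dvd e - 1"
    using dvd_power_card_power_diff[of "p m" "N ^ (CARD('a) ^ degree (p m) - 1)" 1 1]
      place_fermat_power[OF pl[OF m]] by (simp add: e_def)
  moreover have "p j ^ 2 dvd e" if "j \<in> I" "j \<noteq> m" for j
  proof -
    have "CARD('a) ^ 1 \<le> CARD('a) ^ degree (p m)"
      using degree_place_pos[OF pl[OF m]] card_finite_field_ge_2[where 'a = 'a]
      by (intro power_increasing) auto
    \<comment> \<open>The degree is positive and q \<ge> 2, so each other \<open>p j\<close>, a
      factor of N, divides e at least twice.\<close>
    then have "2 \<le> (CARD('a) ^ degree (p m) - 1) * CARD('a)"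
      using card_finite_field_ge_2[where 'a = 'a] mult_le_mono[of 1 _ 2] by auto
    then have "p j ^ 2 dvd p j ^ ((CARD('a) ^ degree (p m) - 1) * CARD('a))"
      by (rule le_imp_power_dvd)
    also have "\<dots> dvd N ^ ((CARD('a) ^ degree (p m) - 1) * CARD('a))"
      using that assms(1) by (intro dvd_power_same) (auto simp: N_def)
    finally show ?thesis by (simp add: e_def power_mult)
  qed
  ultimately show ?thesis by (rule that)
qed

subsection \<open>Twisted polynomials\<close>

lemma tcoeff_0 [simp]: "tcoeff 0 n = 0" by transfer simp
lemma tcoeff_1: "tcoeff 1 n = (if n = 0 then 1 else 0)" by transfer simp
lemma tcoeff_add [simp]: "tcoeff (c + d) n = tcoeff c n + tcoeff d n" by transfer simp
lemma tcoeff_diff [simp]: "tcoeff (c - d) n = tcoeff c n - tcoeff d n" by transfer simp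

lemma tcoeff_times:
  "tcoeff (c * d) n = (\<Sum>i\<le>n. tcoeff c i * tcoeff d (n - i) ^ (CARD('a) ^ i))"
  for c d :: "'a::finite_field twisted"
  by transfer simp

lemma tcoeff_eventually_0: "\<exists>N. \<forall>n>N. tcoeff c n = 0"
  using tcoeff[of c] by (auto simp: MOST_nat)

lemma tact_eq:
  fixes c :: "'a::finite_field twisted"
  assumes "\<And>n. n > N \<Longrightarrow> tcoeff c n = 0"
  shows "tact c x = (\<Sum>i\<le>N. tcoeff c i * x ^ (CARD('a) ^ i))"
  unfolding tact_def
  by (rule sum.mono_neutral_cong_left) (use assms in \<open>auto simp: not_le[symmetric]\<close>)

lemma tact_add_left: "tact (c + d) x = tact c x + tact d x"
  for c d :: "'a::finite_field twisted"
proof -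
  obtain M N where M: "\<forall>n>M. tcoeff c n = 0" and N: "\<forall>n>N. tcoeff d n = 0"
    using tcoeff_eventually_0 by metis
  let ?L = "max M N"
  have "tact (c + d) x = (\<Sum>i\<le>?L. tcoeff (c + d) i * x ^ (CARD('a) ^ i))"
    using M N by (intro tact_eq) simp
  moreover have "tact c x = (\<Sum>i\<le>?L. tcoeff c i * x ^ (CARD('a) ^ i))"
    using M by (intro tact_eq) simp
  moreover have "tact d x = (\<Sum>i\<le>?L. tcoeff d i * x ^ (CARD('a) ^ i))"
    using N by (intro tact_eq) simp
  ultimately show ?thesis by (simp add: sum.distrib distrib_right)
qed

lemma tact_0_left [simp]: "tact 0 x = 0"
  by (simp add: tact_def)

lemma tact_diff_left: "tact (c - d) x = tact c x - tact d x"
  for c d :: "'a::finite_field twisted"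
  using tact_add_left[of "c - d" d x] by simp

lemma tact_diff_right: "tact c (x - y) = tact c x - tact c y"
  for c :: "'a::finite_field twisted"
  by (simp add: tact_def poly_diff_power_card_power right_diff_distrib sum_subtractf)

text \<open>All exponents q^i are positive, so each term contains x. With additivity this makes the
  action compatible with congruences.\<close>

lemma dvd_tact: "x dvd tact c x"
  for c :: "'a::finite_field twisted"
  unfolding tact_def by (intro dvd_sum dvd_mult dvd_power) auto

lemma tact_tconst [simp]: "tact (tconst a) x = a * x"
  by (subst tact_eq[where N = 0]) auto

text \<open>Both sides sum c_i d_j^(q^i) x^(q^(i+j)) over all i, j: the twist in the product is the
  power that Frobenius puts on the coefficients of the inner sum.\<close>

lemma tact_times: "tact (c * d) x = tact c (tact d x)"
  for c d :: "'a::finite_field twisted"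
proof -
  let ?q = "CARD('a)"
  obtain M N where M: "\<forall>n>M. tcoeff c n = 0" and N: "\<forall>n>N. tcoeff d n = 0"
    using tcoeff_eventually_0 by metis
  define f where "f i j = tcoeff c i * tcoeff d j ^ (?q ^ i) * x ^ (?q ^ (i + j))" for i j
  have f0: "f i j = 0" if "i > M \<or> j > N" for i j
    using that M N by (auto simp: f_def)
  have "tcoeff (c * d) n = 0" if "n > M + N" for n
    unfolding tcoeff_times
  proof (intro sum.neutral ballI)
    fix i
    show "tcoeff c i * tcoeff d (n - i) ^ (?q ^ i) = 0"
      using M N that by (cases "i > M") auto
  qed
  then have "tact (c * d) x = (\<Sum>n\<le>M + N. tcoeff (c * d) n * x ^ (?q ^ n))"
    by (rule tact_eq)
  also have "\<dots> = (\<Sum>n\<le>M + N. \<Sum>i\<le>n. f i (n - i))"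
    by (simp add: tcoeff_times f_def sum_distrib_right)
  also have "\<dots> = (\<Sum>(i, j) | i + j \<le> M + N. f i j)"
    by (rule sum.triangle_reindex_eq[symmetric])
  \<comment> \<open>The triangle contains the rectangle, and \<open>f i j\<close> vanishes outside
    the rectangle.\<close>
  also have "\<dots> = (\<Sum>(i, j)\<in>{..M} \<times> {..N}. f i j)"
    by (rule sum.mono_neutral_right)
      (auto intro: finite_subset[of _ "{..M + N} \<times> {..M + N}"] f0 simp: not_le)
  also have "\<dots> = (\<Sum>i\<le>M. \<Sum>j\<le>N. f i j)"
    by (simp add: sum.cartesian_product)
  also have "\<dots> = (\<Sum>i\<le>M. tcoeff c i * (\<Sum>j\<le>N. tcoeff d j * x ^ (?q ^ j)) ^ (?q ^ i))"
    by (simp add: f_def poly_sum_power_card_power sum_distrib_left power_mult_distrib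
        power_add mult_ac flip: power_mult)
  also have "\<dots> = tact c (tact d x)"
    using M N by (simp add: tact_eq[where N = M] tact_eq[where N = N])
  finally show ?thesis .
qed

lemma tconst_0 [simp]: "tconst 0 = 0"
  by (rule twisted_eqI) simp

lemma tconst_add: "tconst (a + b) = tconst a + tconst b"
  by (rule twisted_eqI) simp

lemma tcoeff_tconst_times [simp]: "tcoeff (tconst a * c) n = a * tcoeff c n"
  by (simp add: tcoeff_times if_distrib[of "\<lambda>x. x * _"] cong: if_cong)

lemma tconst_times: "tconst (a * b) = tconst a * tconst b"
  by (rule twisted_eqI) simp

text \<open>Constants satisfy k^q = k, so the Frobenius twist fixes them.\<close>

lemma times_tconst_field: "c * tconst [:k:] = tconst [:k:] * c"
  for c :: "'a::finite_field twisted"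
proof (rule twisted_eqI)
  fix n
  have "[:k:] ^ m = [:k ^ m:]" for m by (induction m) (auto simp: one_pCons)
  moreover have "k ^ (CARD('a) ^ i) = k" for i
    by (induction i) (simp_all add: power_mult finite_field_power_card_eq_same)
  ultimately have k: "[:k:] ^ (CARD('a) ^ i) = [:k:]" for i by simp
  have "tcoeff (c * tconst [:k:]) n = (\<Sum>i\<le>n. if i = n then tcoeff c i * [:k:] else 0)"
    unfolding tcoeff_times by (rule sum.cong) (auto simp: k)
  then show "tcoeff (c * tconst [:k:]) n = tcoeff (tconst [:k:] * c) n"
    by (simp add: mult.commute)
qed

text \<open>Horner scheme for substituting T for t. It yields the homomorphism over the constants
  that sends t to T; multiplicativity rests on the centrality of the constants.\<close>

definition twisted_eval :: "'a::finite_field twisted \<Rightarrow> 'a poly \<Rightarrow> 'a twisted"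
  where "twisted_eval T a = fold_coeffs (\<lambda>k s. tconst [:k:] + T * s) a 0"

lemma twisted_eval_0 [simp]: "twisted_eval T 0 = 0"
  by (simp add: twisted_eval_def)

lemma twisted_eval_pCons: "twisted_eval T (pCons k a) = tconst [:k:] + T * twisted_eval T a"
proof (cases "a = 0")
  case True
  then show ?thesis by (cases "k = 0") (simp_all add: twisted_eval_def)
qed (simp add: twisted_eval_def)

lemma twisted_eval_add: "twisted_eval T (a + b) = twisted_eval T a + twisted_eval T b"
proof (induction a b rule: poly_induct2)
  case (pCons k a l b)
  have "tconst [:k + l:] = tconst [:k:] + tconst [:l:]" by (simp flip: tconst_add)
  then show ?case using pCons by (simp add: twisted_eval_pCons distrib_left)
qed simp

lemma twisted_eval_smult: "twisted_eval T (smult k a) = tconst [:k:] * twisted_eval T a"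
proof (induction a)
  case (pCons l a)
  have "tconst [:k * l:] = tconst [:k:] * tconst [:l:]"
    using tconst_times[of "[:k:]" "[:l:]"] by (simp add: mult.commute)
  moreover have "T * (tconst [:k:] * twisted_eval T a) = tconst [:k:] * (T * twisted_eval T a)"
    by (metis mult.assoc times_tconst_field)
  ultimately show ?case using pCons
    by (simp add: twisted_eval_pCons distrib_left mult.assoc)
qed simp

lemma twisted_eval_mult: "twisted_eval T (a * b) = twisted_eval T a * twisted_eval T b"
  by (induction a)
    (simp_all add: twisted_eval_pCons twisted_eval_add twisted_eval_smult distrib_right mult.assoc)

lemma twisted_eval_const: "twisted_eval T [:k:] = tconst [:k:]"
  by (simp add: twisted_eval_pCons)

lemma twisted_eval_X: "twisted_eval T [:0, 1:] = T"
  for T :: "'a::finite_field twisted"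
proof -
  have "tconst [:1:] = (1 :: 'a twisted)" by (rule twisted_eqI) (simp add: tcoeff_1 one_pCons)
  then show ?thesis by (simp add: twisted_eval_pCons)
qed

text \<open>Every such homomorphism respects the Horner recursion \<open>pCons k a\<close> = k + t
  a, so the image of t determines it.\<close>

lemma twisted_eval_unique:
  assumes "\<And>a b. \<phi> (a + b) = \<phi> a + \<phi> b" "\<And>a b. \<phi> (a * b) = \<phi> a * \<phi> b"
    and "\<And>k. \<phi> [:k:] = tconst [:k:]"
  shows "\<phi> = twisted_eval (\<phi> [:0, 1:])"
proof
  fix a
  show "\<phi> a = twisted_eval (\<phi> [:0, 1:]) a"
  proof (induction a)
    case 0
    show ?case using assms(3)[of 0] by simp
  next
    case (pCons k a)
    have "pCons k a = [:k:] + [:0, 1:] * a" by simp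
    then have "\<phi> (pCons k a) = tconst [:k:] + \<phi> [:0, 1:] * \<phi> a"
      by (metis assms)
    then show ?case using pCons by (simp add: twisted_eval_pCons)
  qed
qed

subsection \<open>Small models\<close>

text \<open>The tuples (g_1, ..., g_r), encoded as twisted polynomials without constant term; the
  top entry may be zero, which makes the set an additive group.\<close>

definition small_coeffs :: "nat \<Rightarrow> 'a::finite_field twisted set"
  where "small_coeffs r = {c. tcoeff c 0 = 0 \<and> (\<forall>i. degree (tcoeff c i) \<le> CARD('a) ^ i) \<and>
    (\<forall>i>r. tcoeff c i = 0)}"

lemma add_subgroup_small_coeffs: "add_subgroup (small_coeffs r)"
  by (auto simp: add_subgroup_def small_coeffs_def intro: degree_diff_le)

lemma finite_small_coeffs: "finite (small_coeffs r :: 'a::finite_field twisted set)"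
proof (rule finite_imageD)
  let ?B = "{f :: 'a poly. degree f \<le> CARD('a) ^ r}"
  show "finite (tcoeff ` (small_coeffs r :: 'a twisted set))"
  proof (rule finite_subset)
    show "finite {f. \<forall>i. (i \<in> {..r} \<longrightarrow> f i \<in> ?B) \<and> (i \<notin> {..r} \<longrightarrow> f i = 0)}"
      by (intro finite_set_of_finite_funs finite_degree_le) simp
    have "degree (tcoeff c i) \<le> CARD('a) ^ r" if "c \<in> small_coeffs r" "i \<le> r" for c :: "'a twisted" and i
    proof -
      have "degree (tcoeff c i) \<le> CARD('a) ^ i" using that by (simp add: small_coeffs_def)
      also have "\<dots> \<le> CARD('a) ^ r" using that by (intro power_increasing) auto
      finally show ?thesis .
    qed
    then show "tcoeff ` (small_coeffs r :: 'a twisted set) \<subseteq>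
        {f. \<forall>i. (i \<in> {..r} \<longrightarrow> f i \<in> ?B) \<and> (i \<notin> {..r} \<longrightarrow> f i = 0)}"
      by (auto simp: small_coeffs_def)
  qed
  show "inj_on tcoeff (small_coeffs r :: 'a twisted set)"
    by (simp add: inj_on_def tcoeff_inject)
qed

definition model :: "'a::finite_field twisted \<Rightarrow> 'a poly \<Rightarrow> 'a twisted"
  where "model c = twisted_eval (tconst [:0, 1:] + c)"

lemma model_X: "model c [:0, 1:] = tconst [:0, 1:] + c"
  by (simp add: model_def twisted_eval_X)

lemma inj_model: "inj model"
  by (rule injI) (metis model_X add_left_cancel)

lemma model_unique:
  assumes "\<And>a b. \<phi> (a + b) = \<phi> a + \<phi> b" "\<And>a b. \<phi> (a * b) = \<phi> a * \<phi> b"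
    and "\<And>k. \<phi> [:k:] = tconst [:k:]"
  shows "\<phi> = model (\<phi> [:0, 1:] - tconst [:0, 1:])"
  using twisted_eval_unique[of \<phi>, OF assms] by (simp add: model_def)

lemma model_0: "model 0 = tconst"
  using model_unique[of tconst, symmetric] by (simp add: tconst_add tconst_times)

text \<open>The image of t determines a model. Conversely, a nonzero c gives a model whose rank is
  the top index of its support, and c = 0 gives the degenerate \<open>tconst\<close>.\<close>

lemma small_models_eq: "small_models r = model ` small_coeffs r"
proof (intro equalityI subsetI)
  fix \<phi> :: "'a poly \<Rightarrow> 'a twisted" assume "\<phi> \<in> small_models r"
  then consider "\<phi> = tconst" | s where "small_model \<phi>" "s \<le> r" "drinfeld_model s \<phi>"
    by (auto simp: small_models_def)
  then show "\<phi> \<in> model ` small_coeffs r"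
  proof cases
    case 1
    then show ?thesis
      using add_subgroup_0[OF add_subgroup_small_coeffs] by (metis model_0 image_eqI)
  next
    case 2
    then have "\<phi> = model (\<phi> [:0, 1:] - tconst [:0, 1:])"
      by (intro model_unique) (auto simp: drinfeld_model_def)
    moreover have "\<phi> [:0, 1:] - tconst [:0, 1:] \<in> small_coeffs r"
      using 2 by (auto simp: small_coeffs_def drinfeld_model_def small_model_def)
    ultimately show ?thesis by blast
  qed
next
  fix \<phi> :: "'a poly \<Rightarrow> 'a twisted" assume "\<phi> \<in> model ` small_coeffs r"
  then obtain c where c: "\<phi> = model c" "c \<in> small_coeffs r" by blast
  show "\<phi> \<in> small_models r"
  proof (cases "c = 0")
    case True
    then show ?thesis by (simp add: c model_0 small_models_def)
  next
    case False
    define S where "S = {i. tcoeff c i \<noteq> 0}"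
    have S: "S \<subseteq> {1..r}"
      using c(2) by (auto simp: S_def small_coeffs_def not_less[symmetric]) (metis neq0_conv)
    have fin: "finite S" using S by (rule finite_subset) simp
    have ne: "S \<noteq> {}" using False twisted_eqI[of c 0] by (auto simp: S_def)
    have Max: "Max S \<in> S" using fin ne by (rule Max_in)
    have lead: "tcoeff c (Max S) \<noteq> 0" using Max unfolding S_def by blast
    have above: "tcoeff c i = 0" if "i > Max S" for i
      using Max_ge[OF fin, of i] that unfolding S_def by auto
    have s: "1 \<le> Max S" "Max S \<le> r" using Max S by auto
    have "drinfeld_model (Max S) \<phi>"
      unfolding drinfeld_model_def c(1) model_X
      using s(1) lead above c(2)
      by (simp add: model_def twisted_eval_add twisted_eval_mult twisted_eval_const small_coeffs_def)
    moreover have "small_model \<phi>"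
      using c(2) unfolding small_model_def c(1) model_X by (auto simp: small_coeffs_def)
    ultimately show ?thesis using s(2) unfolding small_models_def by blast
  qed
qed

section \<open>Dependence of the Wieferich condition on residue classes of coefficients\<close>

definition vanishing :: "'a::finite_field poly \<Rightarrow> 'a twisted set"
  where "vanishing P = {c. \<forall>x. P dvd tact c x}"

lemma add_subgroup_vanishing: "add_subgroup (vanishing P)"
  by (auto simp: add_subgroup_def vanishing_def tact_diff_left)

text \<open>Induction along the Horner scheme: for the values u, v at a, (t + d)u - (t + c)v = (d -
  c)u + (t + c)(u - v). The hypothesis handles the first summand, the induction hypothesis with
  \<open>dvd_tact\<close> the second.\<close>

lemma dvd_tact_model_diff:
  assumes "d - c \<in> vanishing P"
  shows "P dvd tact (model d a) x - tact (model c a) x"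
proof (induction a)
  case 0
  show ?case by (simp add: model_def)
next
  case (pCons k a)
  let ?T = "tconst [:0, 1:]"
  let ?u = "tact (model d a) x" and ?v = "tact (model c a) x"
  have "P dvd tact ((?T + d) - (?T + c)) ?u" using assms by (simp add: vanishing_def)
  moreover have "P dvd tact (?T + c) (?u - ?v)" using pCons(2) dvd_tact by (rule dvd_trans)
  ultimately have "P dvd tact ((?T + d) - (?T + c)) ?u + tact (?T + c) (?u - ?v)"
    by (rule dvd_add)
  then have "P dvd tact (?T + d) ?u - tact (?T + c) ?v"
    unfolding tact_diff_left tact_diff_right by simp
  then show ?case
    by (simp add: model_def twisted_eval_pCons tact_add_left[of "tconst [:k:]"] tact_times)
qed

lemma wieferich_model_cong:
  fixes p :: "'a::finite_field poly"
  assumes "d - c \<in> vanishing (p ^ 2)"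
  shows "wieferich (model d) x p \<longleftrightarrow> wieferich (model c) x p"
proof -
  have dvd2: "p ^ 2 dvd tact (model d a) x - tact (model c a) x" for a
    using assms by (rule dvd_tact_model_diff)
  then have "p dvd tact (model d a) x - tact (model c a) x" for a
    using dvd_trans[of p "p ^ 2"] by (simp add: power2_eq_square)
  moreover have "P dvd u \<longleftrightarrow> P dvd v" if "P dvd u - v" for P u v :: "'a poly"
    using dvd_add_right_iff[OF that, of v] by simp
  ultimately have "p dvd tact (model d a) x \<longleftrightarrow> p dvd tact (model c a) x"
    "p ^ 2 dvd tact (model d a) x \<longleftrightarrow> p ^ 2 dvd tact (model c a) x" for a
    using dvd2 by blast+
  then show ?thesis
    by (simp add: wieferich_def pi_ideal_def principal_ideal_def flip: dvd_def)
qed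

text \<open>Modulo \<open>p ^ 2\<close> the power map with exponent \<open>q ^ i\<close> depends for \<open>i \<ge> 1\<close> only on \<open>i\<close> modulo
  \<open>degree p\<close>, so all terms can be moved into the top \<open>degree p\<close> positions.\<close>

lemma tact_fold_top:
  fixes c :: "'a::finite_field twisted"
  assumes p: "place p" and c: "c \<in> small_coeffs r"
  obtains u where "\<And>x. p ^ 2 dvd (\<Sum>i\<in>{r - degree p<..r}. u i * x ^ (CARD('a) ^ i)) - tact c x"
proof -
  define d where "d = degree p"
  have d: "d > 0" using degree_place_pos[OF p] by (simp add: d_def)
  \<comment> \<open>For j \<le> r this is the largest index up to r that is congruent to j modulo
    d.\<close>
  define h where "h j = r - (r - j) mod d" for j
  have h_eq: "h j = j + (r - j) div d * d" if "j \<le> r" for j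
  proof -
    have "(r - j) div d * d + (r - j) mod d = r - j" by simp
    then show ?thesis using that unfolding h_def by linarith
  qed
  have h_top: "h j \<in> {r - d<..r}" if "j \<in> {1..r}" for j
  proof -
    have "(r - j) mod d < d" using d by simp
    \<comment> \<open>As j \<ge> 1, \<open>h j\<close> stays positive even when r < d, where
      \<open>r - d\<close> is truncated to 0.\<close>
    moreover have "(r - j) mod d < r"
      by (rule le_less_trans[OF mod_less_eq_dividend]) (use that in simp)
    ultimately show ?thesis using diff_less_mono2 by (simp add: h_def)
  qed
  define u where "u i = (\<Sum>j\<in>{j\<in>{1..r}. h j = i}. tcoeff c j)" for i
  have "p ^ 2 dvd (\<Sum>i\<in>{r - d<..r}. u i * x ^ (CARD('a) ^ i)) - tact c x" for x
  proof -
    have "(\<Sum>i\<in>{r - d<..r}. u i * x ^ (CARD('a) ^ i)) =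
        (\<Sum>i\<in>{r - d<..r}. \<Sum>j\<in>{j\<in>{1..r}. h j = i}. tcoeff c j * x ^ (CARD('a) ^ h j))"
      by (simp add: u_def sum_distrib_right)
    also have "\<dots> = (\<Sum>j\<in>{1..r}. tcoeff c j * x ^ (CARD('a) ^ h j))"
      by (rule sum.group) (use h_top in auto)
    moreover have "tact c x = (\<Sum>j\<in>{1..r}. tcoeff c j * x ^ (CARD('a) ^ j))"
    proof -
      have "tact c x = (\<Sum>j\<le>r. tcoeff c j * x ^ (CARD('a) ^ j))"
        using c by (intro tact_eq) (simp add: small_coeffs_def)
      also have "\<dots> = (\<Sum>j\<in>{1..r}. tcoeff c j * x ^ (CARD('a) ^ j))"
        by (rule sum.mono_neutral_right)
          (use c in \<open>auto simp: small_coeffs_def not_le less_Suc_eq_0_disj\<close>)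
      finally show ?thesis .
    qed
    ultimately have "(\<Sum>i\<in>{r - d<..r}. u i * x ^ (CARD('a) ^ i)) - tact c x =
        (\<Sum>j\<in>{1..r}. tcoeff c j * (x ^ (CARD('a) ^ h j) - x ^ (CARD('a) ^ j)))"
      by (simp add: sum_subtractf right_diff_distrib)
    also have "p ^ 2 dvd \<dots>"
      using place_power_card_shift[OF p] by (intro dvd_sum dvd_mult) (auto simp: h_eq d_def)
    finally show ?thesis .
  qed
  then show ?thesis unfolding d_def by (rule that)
qed

text \<open>The coefficients of w are those of v folded into the top positions, multiplied by an
  \<open>e\<close> that is 1 modulo p_m^2 and 0 modulo the other squares, and reduced modulo the
  product of all squares to meet the degree bound.\<close>

lemma small_coeffs_split:
  fixes p :: "nat \<Rightarrow> 'a::finite_field poly"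
  assumes I: "finite I" "\<And>m. m \<in> I \<Longrightarrow> place (p m)" "inj_on p I" and m: "m \<in> I"
    and large: "2 * (\<Sum>j\<in>I. degree (p j)) \<le> CARD('a) ^ (r - degree (p m))"
    and v: "v \<in> small_coeffs r"
  shows "\<exists>w\<in>small_coeffs r. w - v \<in> vanishing (p m ^ 2) \<and> (\<forall>j\<in>I - {m}. w \<in> vanishing (p j ^ 2))"
proof -
  let ?q = "CARD('a)" and ?T = "{r - degree (p m)<..r}"
  obtain u where u: "\<And>x. p m ^ 2 dvd (\<Sum>i\<in>?T. u i * x ^ (?q ^ i)) - tact v x"
    using tact_fold_top[OF I(2)[OF m] v] by metis
  obtain e where e: "p m ^ 2 dvd e - 1" "\<And>j. j \<in> I \<Longrightarrow> j \<noteq> m \<Longrightarrow> p j ^ 2 dvd e"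
    using place_idempotent[OF I m] by metis
  define Q where "Q = (\<Prod>j\<in>I. p j ^ 2)"
  have nz: "p j \<noteq> 0" if "j \<in> I" for j using I(2)[OF that] by (auto simp: place_def)
  have Q0: "Q \<noteq> 0" using nz I(1) by (simp add: Q_def)
  have degQ: "degree Q = 2 * (\<Sum>j\<in>I. degree (p j))"
    unfolding Q_def using nz
    by (subst degree_prod_eq_sum_degree) (auto simp: degree_power_eq sum_distrib_left)
  have dvdQ: "p j ^ 2 dvd f mod Q - f" if "j \<in> I" for j f
  proof -
    have "p j ^ 2 dvd Q" unfolding Q_def using I(1) that by auto
    also have "Q dvd f mod Q - f" by (simp flip: mod_eq_dvd_iff)
    finally show ?thesis .
  qed
  define g where "g i = (if i \<in> ?T then (e * u i) mod Q else 0)" for i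
  define w where "w = Abs_twisted g"
  have "\<forall>\<^sub>\<infinity>i. g i = 0" by (auto simp: MOST_nat g_def intro!: exI[of _ r])
  then have w: "tcoeff w = g" by (simp add: w_def Abs_twisted_inverse)
  have tact_w: "tact w x = (\<Sum>i\<in>?T. (e * u i) mod Q * x ^ (?q ^ i))" for x
  proof -
    have "tact w x = (\<Sum>i\<le>r. g i * x ^ (?q ^ i))"
      unfolding w[symmetric] by (rule tact_eq) (simp add: w g_def)
    also have "\<dots> = (\<Sum>i\<in>?T. g i * x ^ (?q ^ i))"
      by (rule sum.mono_neutral_right) (auto simp: g_def)
    finally show ?thesis by (simp add: g_def)
  qed
  have "degree (g i) \<le> ?q ^ i" for i
  proof (cases "i \<in> ?T")
    case True
    \<comment> \<open>Indices in \<open>?T\<close> exceed r - deg p_m, so \<open>large\<close>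
      bounds deg Q by q^i.\<close>
    have "degree ((e * u i) mod Q) \<le> degree Q"
      using degree_mod_less[OF Q0, of "e * u i"] by auto
    also have "\<dots> \<le> ?q ^ (r - degree (p m))" using large degQ by simp
    also have "\<dots> \<le> ?q ^ i" using True by (intro power_increasing) auto
    finally show ?thesis using True by (simp add: g_def)
  qed (auto simp: g_def)
  then have "w \<in> small_coeffs r" by (auto simp: small_coeffs_def w g_def)
  moreover have "w - v \<in> vanishing (p m ^ 2)"
  proof -
    have "p m ^ 2 dvd (e * u i) mod Q - u i" for i
    proof -
      \<comment> \<open>Reduction modulo Q and multiplication by \<open>e\<close> each change only
        by multiples of p_m^2.\<close>
      have "p m ^ 2 dvd ((e * u i) mod Q - e * u i) + (e - 1) * u i"
        using dvdQ[OF m] e(1) by (intro dvd_add dvd_mult2)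
      then show ?thesis by (simp add: algebra_simps)
    qed
    then have "p m ^ 2 dvd (\<Sum>i\<in>?T. ((e * u i) mod Q - u i) * x ^ (?q ^ i))" for x
      by (intro dvd_sum dvd_mult2)
    \<comment> \<open>Comparison through the folded sum, which is congruent to both actions modulo
      p_m^2.\<close>
    then have "p m ^ 2 dvd (\<Sum>i\<in>?T. ((e * u i) mod Q - u i) * x ^ (?q ^ i)) +
        ((\<Sum>i\<in>?T. u i * x ^ (?q ^ i)) - tact v x)" for x
      using u by (intro dvd_add)
    then show ?thesis
      by (simp add: vanishing_def tact_diff_left tact_w left_diff_distrib sum_subtractf)
  qed
  moreover have "w \<in> vanishing (p j ^ 2)" if "j \<in> I - {m}" for j
  proof -
    have "p j ^ 2 dvd (e * u i) mod Q" for i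
    proof -
      have "p j ^ 2 dvd ((e * u i) mod Q - e * u i) + e * u i"
        using dvdQ[of j] e(2)[of j] that by (intro dvd_add dvd_mult2) auto
      then show ?thesis by simp
    qed
    then show ?thesis by (auto simp: vanishing_def tact_w intro!: dvd_sum dvd_mult2)
  qed
  ultimately show ?thesis by blast
qed

theorem theorem3p8:
  fixes p :: "nat \<Rightarrow> 'a::finite_field poly" and n r :: nat
  assumes "n \<ge> 1"
    and "\<And>m. m \<in> {1..n} \<Longrightarrow> place (p m)"
    and "inj_on p {1..n}"
    and "r \<ge> 1"
    and "real r \<ge> real (Max ((\<lambda>m. degree (p m)) ` {1..n}))
                  + log (real CARD('a)) (2 * real (\<Sum>m=1..n. degree (p m)))"
  shows "prob_space.indep_vars
           (uniform_count_measure (small_models r :: ('a poly \<Rightarrow> 'a twisted) set))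
           (\<lambda>_. count_space {0, 1}) (\<lambda>m. wieferich_var (p m)) {1..n}"
proof -
  let ?q = "CARD('a)" and ?D = "\<Sum>m=1..n. degree (p m)"
  define dmax where "dmax = Max ((\<lambda>m. degree (p m)) ` {1..n})"
  have q: "real ?q > 1" using card_finite_field_ge_2[where 'a = 'a] by simp
  \<comment> \<open>Since n \<ge> 1 and places have positive degree, the logarithm is nonnegative;
    hence \<open>dmax\<close> \<le> r, and the natural subtraction \<open>r - dmax\<close> is not
    truncated.\<close>
  have "degree (p 1) \<le> ?D" using assms(1) by (intro member_le_sum) auto
  moreover have "degree (p 1) > 0" using assms(1,2) by (intro degree_place_pos) auto
  ultimately have "1 \<le> ?D" by linarith
  then have "real 1 \<le> real ?D" by (rule of_nat_mono)
  then have D: "2 * real ?D \<ge> 1" by linarith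
  then have "log ?q (2 * real ?D) \<ge> 0" using q by simp
  then have r: "dmax \<le> r" using assms(5) by (simp add: dmax_def)
  have "log ?q (2 * real ?D) \<le> real (r - dmax)" using assms(5) r by (simp add: dmax_def)
  then have "2 * real ?D \<le> ?q powr real (r - dmax)" using q D by (subst (asm) log_le_iff) auto
  then have "real (2 * ?D) \<le> real (?q ^ (r - dmax))" using q by (simp add: powr_realpow)
  then have top: "2 * ?D \<le> ?q ^ (r - dmax)" by (simp only: of_nat_le_iff)
  have "2 * ?D \<le> ?q ^ (r - degree (p m))" if "m \<in> {1..n}" for m
  proof -
    have "degree (p m) \<le> dmax" unfolding dmax_def using that by (intro Max_ge) auto
    then have "?q ^ (r - dmax) \<le> ?q ^ (r - degree (p m))" by (intro power_increasing) auto
    with top show ?thesis by simp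
  qed
  \<comment> \<open>The bound just obtained, for each m, is the hypothesis \<open>large\<close> of
    the splitting.\<close>
  then show ?thesis
    unfolding small_models_eq
    by (intro indep_vars_uniform_count_measure_image[where K = "\<lambda>m. vanishing (p m ^ 2)"]
        finite_small_coeffs add_subgroup_small_coeffs add_subgroup_vanishing small_coeffs_split
        inj_on_subset[OF inj_model] assms(2,3))
      (auto simp: wieferich_var_def wieferich_model_cong)
qed

end
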